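(* Let $T,Q$ be nonzero rational numbers and $t=T^2Q^{-1}-2$. There is a canonical ring isomorphism $\Phi:\mathcal R(T,Q)\to\mathcal R(t,1)$ defined by the conjugation $\Phi(X)=A^{-1}XA\in\mathcal R(t,1)$, where $$A=\begin{pmatrix}Q&-Q\\0&T\end{pmatrix},$$ and for $X=[x_0\ x_1]\in\mathcal R(T,Q)$, representing the sequence $\{x_n\}_{n\in\mathbb Z}$, $$T\,\Phi(X)=\begin{pmatrix}x_2-tQx_0&-Qx_0\\ Qx_0&x_2\end{pmatrix}.$$ In particular $\Phi(D_{T,Q}^2)=Q\,D_{t,1}$, and $\Phi(Q^{-k}XD_{T,Q}^{2k})=\Phi(X)D_{t,1}^k$ for all $k\in\mathbb Z$.
   Context: For rational $T,Q$ with $Q\ne0$ let $D_{T,Q}=\begin{pmatrix}0&-Q\\1&T\end{pmatrix}$ and let $\mathcal R(T,Q)$ be the ring of all $2\times2$ rational matrices commuting with $D_{T,Q}$. Its elements are the matrices $[x_0\ x_1]:=\begin{pmatrix}x_1-Tx_0&-Qx_0\\ x_0&x_1\end{pmatrix}$, $x_0,x_1\in\mathbb Q$. The element $[x_0\ x_1]$ is identified with the two-sided sequence $\{x_n\}_{n\in\mathbb Z}$ given by $x_{n+1}=Tx_n-Qx_{n-1}$, i.e. $[x_n\ x_{n+1}]=[x_0\ x_1]D_{T,Q}^n$ as row vectors. *)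

theory Defs
  imports "HOL-Analysis.Analysis" "HOL-Algebra.QuotRing"
begin

definition mat22 :: "rat \<Rightarrow> rat \<Rightarrow> rat \<Rightarrow> rat \<Rightarrow> rat^2^2" where
  "mat22 a b c d = vector [vector [a, b], vector [c, d]]"

text \<open>The library scalar multiplication on matrices needs real scalars.\<close>

definition smult_mat :: "rat \<Rightarrow> rat^2^2 \<Rightarrow> rat^2^2"  (infixr \<open>\<cdot>\<^sub>M\<close> 72) where
  "c \<cdot>\<^sub>M M = (\<chi> i j. c * M $ i $ j)"

definition DD :: "rat \<Rightarrow> rat \<Rightarrow> rat^2^2" where
  "DD T Q = mat22 0 (- Q) 1 T"

text \<open>The multiplication is \<open>**\<close>; \<open>*\<close> on \<^typ>\<open>rat^2^2\<close> is componentwise.\<close>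

definition RR :: "rat \<Rightarrow> rat \<Rightarrow> (rat^2^2) ring" where
  "RR T Q = \<lparr>carrier = {X. X ** DD T Q = DD T Q ** X},
             mult = (**), one = mat 1, zero = 0, add = (+)\<rparr>"

definition elt :: "rat \<Rightarrow> rat \<Rightarrow> rat \<Rightarrow> rat \<Rightarrow> rat^2^2" where
  "elt T Q x0 x1 = mat22 (x1 - T * x0) (- Q * x0) x0 x1"

definition represents :: "rat \<Rightarrow> rat \<Rightarrow> rat^2^2 \<Rightarrow> (int \<Rightarrow> rat) \<Rightarrow> bool" where
  "represents T Q X x \<longleftrightarrow>
     X = elt T Q (x 0) (x 1) \<and> (\<forall>n. x (n + 1) = T * x n - Q * x (n - 1))"

definition AA :: "rat \<Rightarrow> rat \<Rightarrow> rat^2^2" where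
  "AA T Q = mat22 Q (- Q) 0 T"

definition Phi :: "rat \<Rightarrow> rat \<Rightarrow> rat^2^2 \<Rightarrow> rat^2^2" where
  "Phi T Q X = matrix_inv (AA T Q) ** X ** AA T Q"

lemma mat22_nth [simp]:
  "mat22 a b c d $ 1 $ 1 = a" "mat22 a b c d $ 1 $ 2 = b"
  "mat22 a b c d $ 2 $ 1 = c" "mat22 a b c d $ 2 $ 2 = d"
  by (simp_all add: mat22_def)

lemma mat22_eq_iff:
  "(X :: rat^2^2) = Y \<longleftrightarrow>
     X$1$1 = Y$1$1 \<and> X$1$2 = Y$1$2 \<and> X$2$1 = Y$2$1 \<and> X$2$2 = Y$2$2"
  by (auto simp: vec_eq_iff forall_2)

lemma matmul22_nth: "((X :: rat^2^2) ** Y) $ i $ j = X$i$1 * Y$1$j + X$i$2 * Y$2$j"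
  by (simp add: matrix_matrix_mult_def sum_2)

lemma matmul_minus: "(- X) ** Y = - (X ** Y)" "X ** (- Y) = - (X ** Y)" for X Y :: "rat^2^2"
  by (simp_all add: mat22_eq_iff matmul22_nth)

lemma matmul_add: "(X + Y) ** Z = X ** Z + Y ** Z" "Z ** (X + Y) = Z ** X + Z ** Y"
  for X Y Z :: "rat^2^2"
  by (simp_all add: mat22_eq_iff matmul22_nth algebra_simps)

lemma mat1_22_nth [simp]:
  "(mat 1 :: rat^2^2) $ 1 $ 1 = 1" "(mat 1 :: rat^2^2) $ 1 $ 2 = 0"
  "(mat 1 :: rat^2^2) $ 2 $ 1 = 0" "(mat 1 :: rat^2^2) $ 2 $ 2 = 1"
  by (simp_all add: mat_def)

lemma elt_in_RR: "elt T Q x0 x1 \<in> carrier (RR T Q)"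
  by (simp add: RR_def elt_def DD_def mat22_eq_iff matmul22_nth algebra_simps)

lemma RR_eq_elt:
  assumes "X \<in> carrier (RR T Q)"
  shows "X = elt T Q (X$2$1) (X$2$2)"
proof -
  have eq: "X ** DD T Q = DD T Q ** X" using assms by (simp add: RR_def)
  have "X$1$2 = - Q * X$2$1"
    using arg_cong[OF eq, of "\<lambda>M. M$1$1"] by (simp add: matmul22_nth DD_def)
  moreover have "X$2$2 = X$1$1 + T * X$2$1"
    using arg_cong[OF eq, of "\<lambda>M. M$2$1"] by (simp add: matmul22_nth DD_def)
  ultimately show ?thesis by (simp add: elt_def mat22_eq_iff)
qed

lemma carrier_RR: "carrier (RR T Q) = {elt T Q x0 x1 | x0 x1. True}"
  using RR_eq_elt elt_in_RR by blast

lemma cring_RR: "cring (RR T Q)"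
proof (rule cringI)
  show "abelian_group (RR T Q)"
  proof (rule abelian_groupI)
    fix X assume "X \<in> carrier (RR T Q)"
    then show "\<exists>Y\<in>carrier (RR T Q). Y \<oplus>\<^bsub>RR T Q\<^esub> X = \<zero>\<^bsub>RR T Q\<^esub>"
      by (intro bexI[of _ "- X"])
         (simp_all add: RR_def matmul_minus)
  qed (auto simp: RR_def matmul_add add.assoc add.commute)
  show "comm_monoid (RR T Q)"
  proof (rule comm_monoidI)
    fix X Y assume "X \<in> carrier (RR T Q)" "Y \<in> carrier (RR T Q)"
    then obtain a b c d where "X = elt T Q a b" "Y = elt T Q c d"
      using RR_eq_elt by metis
    moreover have "elt T Q a b ** elt T Q c d = elt T Q c d ** elt T Q a b"
      by (simp add: elt_def mat22_eq_iff matmul22_nth algebra_simps)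
    ultimately show "X \<otimes>\<^bsub>RR T Q\<^esub> Y = Y \<otimes>\<^bsub>RR T Q\<^esub> X"
      by (simp add: RR_def)
  next
    fix X Y assume "X \<in> carrier (RR T Q)" "Y \<in> carrier (RR T Q)"
    then have X: "X ** DD T Q = DD T Q ** X" and Y: "Y ** DD T Q = DD T Q ** Y"
      by (simp_all add: RR_def)
    have "(X ** Y) ** DD T Q = X ** (DD T Q ** Y)" by (simp only: Y flip: matrix_mul_assoc)
    also have "\<dots> = DD T Q ** (X ** Y)" by (simp only: X matrix_mul_assoc)
    finally show "X \<otimes>\<^bsub>RR T Q\<^esub> Y \<in> carrier (RR T Q)"
      by (simp add: RR_def)
  qed (simp_all add: RR_def matrix_mul_assoc)
qed (simp add: RR_def matmul_add)

lemma DD_unit: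
  assumes "Q \<noteq> 0"
  shows "DD T Q \<in> Units (RR T Q)"
  unfolding Units_def
proof (intro CollectI conjI bexI)
  show "DD T Q \<in> carrier (RR T Q)" by (simp add: RR_def)
  show "elt T Q (- 1 / Q) 0 \<in> carrier (RR T Q)" by (rule elt_in_RR)
qed (use assms in \<open>simp_all add: RR_def elt_def DD_def mat22_eq_iff matmul22_nth field_simps\<close>)

lemma DD_pow_add1:
  assumes "Q \<noteq> 0"
  shows "DD T Q [^]\<^bsub>RR T Q\<^esub> (n + 1 :: int) = DD T Q [^]\<^bsub>RR T Q\<^esub> n ** DD T Q"
    and "DD T Q [^]\<^bsub>RR T Q\<^esub> n \<in> carrier (RR T Q)"
proof -
  interpret cring "RR T Q" by (rule cring_RR)
  interpret U: group "units_of (RR T Q)" by (rule units_group)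
  let ?D = "DD T Q"
  have D: "?D \<in> Units (RR T Q)" by (rule DD_unit[OF assms])
  have nat_pow: "?D [^]\<^bsub>units_of (RR T Q)\<^esub> k = ?D [^]\<^bsub>RR T Q\<^esub> k" for k :: nat
    by (induction k) (simp_all add: units_of_def)
  have DU: "?D \<in> carrier (units_of (RR T Q))" using D by (simp add: units_of_carrier)
  have "?D [^]\<^bsub>RR T Q\<^esub> k \<in> Units (RR T Q)" for k :: nat
    using U.nat_pow_closed[OF DU, of k] by (simp add: nat_pow units_of_carrier)
  then have pow: "?D [^]\<^bsub>units_of (RR T Q)\<^esub> k = ?D [^]\<^bsub>RR T Q\<^esub> k" for k :: int
    unfolding int_pow_def2 nat_pow using units_of_inv by presburger
  have "?D [^]\<^bsub>units_of (RR T Q)\<^esub> (n + 1) =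
        ?D [^]\<^bsub>units_of (RR T Q)\<^esub> n \<otimes>\<^bsub>units_of (RR T Q)\<^esub> ?D"
    using U.int_pow_mult[OF DU, of n 1] U.int_pow_1[OF DU] by simp
  then show "?D [^]\<^bsub>RR T Q\<^esub> (n + 1) = ?D [^]\<^bsub>RR T Q\<^esub> n ** ?D"
    by (simp add: pow units_of_mult) (simp add: RR_def)
  have "?D [^]\<^bsub>units_of (RR T Q)\<^esub> n \<in> carrier (units_of (RR T Q))"
    using DU by (rule U.int_pow_closed)
  then show "?D [^]\<^bsub>RR T Q\<^esub> n \<in> carrier (RR T Q)"
    using Units_closed by (simp add: pow units_of_carrier)
qed

lemma represents_unique:
  assumes Q: "Q \<noteq> 0" and x: "represents T Q X x" and y: "represents T Q X y"
  shows "x = y"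
proof
  fix n
  have rec: "x (n + 1) = T * x n - Q * x (n - 1)" "y (n + 1) = T * y n - Q * y (n - 1)" for n
    using x y by (auto simp: represents_def)
  have "x n = y n \<and> x (n + 1) = y (n + 1)"
  proof (induction n rule: int_induct[where k = 0])
    case base
    show ?case using x y by (auto simp: represents_def elt_def mat22_eq_iff)
  next
    case (step1 i)
    then show ?case using rec[of "i + 1"] by (simp add: add.assoc)
  next
    case (step2 i)
    then have "Q * x (i - 1) = Q * y (i - 1)" using rec[of i] by auto
    with step2 Q show ?case by simp
  qed
  then show "x n = y n" ..
qed

lemma represents_power:
  assumes Q: "Q \<noteq> 0" and X: "X \<in> carrier (RR T Q)"
  shows "represents T Q X (\<lambda>n. (X ** (DD T Q [^]\<^bsub>RR T Q\<^esub> n)) $ 2 $ 1)"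
proof -
  interpret cring "RR T Q" by (rule cring_RR)
  define Y where "Y n = X ** (DD T Q [^]\<^bsub>RR T Q\<^esub> n)" for n :: int
  have step: "Y (n + 1) = Y n ** DD T Q" for n
    by (simp add: Y_def DD_pow_add1[OF Q] matrix_mul_assoc)
  have row: "Y (n + 1) $ 2 $ 1 = Y n $ 2 $ 2"
    "Y (n + 1) $ 2 $ 2 = T * Y n $ 2 $ 2 - Q * Y n $ 2 $ 1" for n
    by (simp_all add: step matmul22_nth DD_def)
  have "Y 0 = X" by (simp add: Y_def) (simp add: RR_def)
  then have "X = elt T Q (Y 0 $ 2 $ 1) (Y 1 $ 2 $ 1)"
    using RR_eq_elt[OF X] row(1)[of 0] by simp
  moreover have "Y (n + 1) $ 2 $ 1 = T * Y n $ 2 $ 1 - Q * Y (n - 1) $ 2 $ 1" for n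
    using row[of "n - 1"] row[of n] by simp
  ultimately show ?thesis by (simp add: represents_def Y_def)
qed

lemma ex1_represents:
  assumes "Q \<noteq> 0" and "X \<in> carrier (RR T Q)"
  shows "\<exists>!x. represents T Q X x"
  using represents_power[OF assms] represents_unique[OF assms(1)] by blast

end

theory Submission
  imports Defs
begin

text \<open>
  The characteristic polynomial of \<open>D = DD T Q\<close> gives \<open>D\<^sup>2 = T D - Q\<close>.  This has two
  consequences.

  \<^item> As \<open>T \<noteq> 0\<close>, the matrix \<open>D\<close> is a polynomial in \<open>D\<^sup>2\<close>, so the ring \<open>RR T Q\<close>, which is the
    centralizer of \<open>D\<close>, is also the centralizer of \<open>D\<^sup>2\<close> (\<open>RR_iff_commutes_square\<close>).
  \<^item> The matrix \<open>Q\<^sup>-\<^sup>1 D\<^sup>2\<close> has determinant 1 and trace \<open>(T\<^sup>2 - 2 Q) / Q = t\<close>.  It is therefore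
    conjugate to the companion matrix \<open>DD t 1\<close>, and \<open>AA T Q\<close> is a matrix that does the
    conjugation (\<open>square_intertwining\<close>): its columns are the images under
    \<open>1\<close> and \<open>Q\<^sup>-\<^sup>1 D\<^sup>2\<close> of the cyclic vector \<open>(Q, 0)\<close>.

  So conjugation by \<open>AA T Q\<close>, an automorphism of the full matrix algebra, takes the centralizer
  of \<open>D\<^sup>2\<close> onto the centralizer of \<open>Q \<cdot>\<^sub>M DD t 1\<close>, which is \<open>RR t 1\<close>.  The identity for the powers
  holds because both sides are multiplied by \<open>DD t 1\<close> when \<open>k\<close> grows by one, and a two-sided
  sequence of this kind is determined by its term at 0 (\<open>DD_orbit_unique\<close>).
\<close>

section \<open>Scalar multiples of matrices\<close>

lemma smult_mat_nth [simp]: "(c \<cdot>\<^sub>M M) $ i $ j = c * M $ i $ j"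
  by (simp add: smult_mat_def)

lemma smult_mat_matmul:
  "(c \<cdot>\<^sub>M X) ** Y = c \<cdot>\<^sub>M (X ** Y)" "X ** (c \<cdot>\<^sub>M Y) = c \<cdot>\<^sub>M (X ** Y)"
  by (simp_all add: mat22_eq_iff matmul22_nth algebra_simps)

lemma smult_mat_smult_mat: "c \<cdot>\<^sub>M d \<cdot>\<^sub>M X = (c * d) \<cdot>\<^sub>M X"
  by (simp add: mat22_eq_iff)

lemma smult_mat_one: "1 \<cdot>\<^sub>M X = X"
  by (simp add: mat22_eq_iff)

lemma smult_mat_cancel: "c \<noteq> 0 \<Longrightarrow> c \<cdot>\<^sub>M X = c \<cdot>\<^sub>M Y \<longleftrightarrow> X = Y"
  by (simp add: mat22_eq_iff)

section \<open>The square of the companion matrix\<close>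

lemma DD_square: "DD T Q ** DD T Q = T \<cdot>\<^sub>M DD T Q - Q \<cdot>\<^sub>M mat 1"
  by (simp add: mat22_eq_iff matmul22_nth DD_def)

text \<open>By \<open>DD_square\<close> the commutator of \<open>X\<close> with the square is \<open>T\<close> times the commutator of \<open>X\<close> with
  the companion matrix itself.\<close>

lemma RR_iff_commutes_square:
  assumes "T \<noteq> 0"
  shows "X \<in> carrier (RR T Q) \<longleftrightarrow> X ** (DD T Q ** DD T Q) = (DD T Q ** DD T Q) ** X"
proof -
  have "X ** (T \<cdot>\<^sub>M DD T Q - Q \<cdot>\<^sub>M mat 1) = T \<cdot>\<^sub>M (X ** DD T Q) - Q \<cdot>\<^sub>M X"
    "(T \<cdot>\<^sub>M DD T Q - Q \<cdot>\<^sub>M mat 1) ** X = T \<cdot>\<^sub>M (DD T Q ** X) - Q \<cdot>\<^sub>M X"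
    by (simp_all add: mat22_eq_iff matmul22_nth algebra_simps)
  then show ?thesis
    using smult_mat_cancel[OF assms] by (simp add: DD_square RR_def)
qed

lemma square_intertwining:
  assumes "Q \<noteq> 0" and "t = T^2 * inverse Q - 2"
  shows "(DD T Q ** DD T Q) ** AA T Q = AA T Q ** (Q \<cdot>\<^sub>M DD t 1)"
proof -
  have T2: "T * T = Q * (t + 2)"
    using assms by (simp add: field_simps power2_eq_square)
  then have "T * (T * T) = Q * (T * (t + 2))" by simp
  with T2 show ?thesis
    by (simp add: mat22_eq_iff matmul22_nth DD_def AA_def algebra_simps)
qed

section \<open>Conjugation\<close>

lemma invertible_AA:
  assumes "T \<noteq> 0" and "Q \<noteq> 0"
  shows "invertible (AA T Q)"
  unfolding invertible_def
proof (intro exI conjI)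
  show "AA T Q ** mat22 (1 / Q) (1 / T) 0 (1 / T) = mat 1"
    and "mat22 (1 / Q) (1 / T) 0 (1 / T) ** AA T Q = mat 1"
    using assms by (simp_all add: mat22_eq_iff matmul22_nth AA_def)
qed

lemma matrix_inv_AA:
  assumes "T \<noteq> 0" and "Q \<noteq> 0"
  shows "AA T Q ** matrix_inv (AA T Q) = mat 1" "matrix_inv (AA T Q) ** AA T Q = mat 1"
  using someI_ex[OF invertible_AA[OF assms, unfolded invertible_def]]
  unfolding matrix_inv_def by blast+

text \<open>This turns every question about the value of the conjugation into one about an
  intertwining relation, in which no inverse matrix occurs.\<close>

lemma Phi_eq_iff:
  assumes "T \<noteq> 0" and "Q \<noteq> 0"
  shows "Phi T Q X = Y \<longleftrightarrow> X ** AA T Q = AA T Q ** Y"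
proof -
  let ?A = "AA T Q" and ?B = "matrix_inv (AA T Q)"
  note inv = matrix_inv_AA[OF assms]
  show ?thesis
  proof
    assume "Phi T Q X = Y"
    then have "?A ** Y = (?A ** ?B) ** X ** ?A"
      by (auto simp: Phi_def matrix_mul_assoc)
    then show "X ** ?A = ?A ** Y" by (simp add: inv)
  next
    assume "X ** ?A = ?A ** Y"
    then have "Phi T Q X = (?B ** ?A) ** Y"
      by (simp add: Phi_def flip: matrix_mul_assoc)
    then show "Phi T Q X = Y" by (simp add: inv)
  qed
qed

lemma AA_Phi:
  assumes "T \<noteq> 0" and "Q \<noteq> 0"
  shows "X ** AA T Q = AA T Q ** Phi T Q X"
  using Phi_eq_iff[OF assms] by blast

lemma Phi_one: "T \<noteq> 0 \<Longrightarrow> Q \<noteq> 0 \<Longrightarrow> Phi T Q (mat 1) = mat 1"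
  by (simp add: Phi_eq_iff)

lemma Phi_mult:
  assumes "T \<noteq> 0" and "Q \<noteq> 0"
  shows "Phi T Q (X ** Y) = Phi T Q X ** Phi T Q Y"
proof -
  have "(X ** Y) ** AA T Q = (X ** AA T Q) ** Phi T Q Y"
    using AA_Phi[OF assms, of Y] by (simp flip: matrix_mul_assoc)
  also have "\<dots> = AA T Q ** (Phi T Q X ** Phi T Q Y)"
    using AA_Phi[OF assms, of X] by (simp add: matrix_mul_assoc)
  finally show ?thesis by (simp add: Phi_eq_iff assms)
qed

lemma Phi_add: "Phi T Q (X + Y) = Phi T Q X + Phi T Q Y"
  by (simp add: Phi_def matmul_add)

lemma Phi_smult: "Phi T Q (c \<cdot>\<^sub>M X) = c \<cdot>\<^sub>M Phi T Q X"
  by (simp add: Phi_def smult_mat_matmul)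

lemma bij_Phi:
  assumes "T \<noteq> 0" and "Q \<noteq> 0"
  shows "bij (Phi T Q)"
proof -
  let ?A = "AA T Q" and ?B = "matrix_inv (AA T Q)"
  note inv = matrix_inv_AA[OF assms]
  show ?thesis
  proof (rule o_bij[where g = "\<lambda>Y. ?A ** Y ** ?B"])
    show "(\<lambda>Y. ?A ** Y ** ?B) \<circ> Phi T Q = id"
    proof
      fix X
      have "?A ** Phi T Q X ** ?B = X ** (?A ** ?B)"
        by (simp add: matrix_mul_assoc flip: AA_Phi[OF assms])
      then show "((\<lambda>Y. ?A ** Y ** ?B) \<circ> Phi T Q) X = id X" by (simp add: inv)
    qed
    show "Phi T Q \<circ> (\<lambda>Y. ?A ** Y ** ?B) = id"
    proof
      fix Y
      have "?A ** Y ** ?B ** ?A = ?A ** Y"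
        using inv by (simp flip: matrix_mul_assoc)
      then show "(Phi T Q \<circ> (\<lambda>Y. ?A ** Y ** ?B)) Y = id Y"
        by (simp add: Phi_eq_iff assms)
    qed
  qed
qed

lemma Phi_square:
  assumes "T \<noteq> 0" and "Q \<noteq> 0" and "t = T^2 * inverse Q - 2"
  shows "Phi T Q (DD T Q ** DD T Q) = Q \<cdot>\<^sub>M DD t 1"
  using square_intertwining assms by (simp add: Phi_eq_iff)

text \<open>Conjugation preserves and reflects commutation.  It takes the square of \<open>DD T Q\<close> to a nonzero
  multiple of \<open>DD t 1\<close>, so it matches the two centralizers.\<close>

lemma Phi_in_RR_iff:
  assumes "T \<noteq> 0" and "Q \<noteq> 0" and "t = T^2 * inverse Q - 2"
  shows "Phi T Q X \<in> carrier (RR t 1) \<longleftrightarrow> X \<in> carrier (RR T Q)"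
proof -
  let ?S = "DD T Q ** DD T Q"
  have "X \<in> carrier (RR T Q) \<longleftrightarrow> X ** ?S = ?S ** X"
    by (rule RR_iff_commutes_square[OF assms(1)])
  also have "\<dots> \<longleftrightarrow> Phi T Q (X ** ?S) = Phi T Q (?S ** X)"
    by (rule inj_eq[OF bij_is_inj[OF bij_Phi[OF assms(1,2)]], symmetric])
  also have "\<dots> \<longleftrightarrow> Q \<cdot>\<^sub>M (Phi T Q X ** DD t 1) = Q \<cdot>\<^sub>M (DD t 1 ** Phi T Q X)"
    by (simp only: Phi_mult[OF assms(1,2), of X] Phi_mult[OF assms(1,2), of ?S] Phi_square[OF assms]
        smult_mat_matmul)
  also have "\<dots> \<longleftrightarrow> Phi T Q X \<in> carrier (RR t 1)"
    using smult_mat_cancel[OF assms(2)] by (simp add: RR_def)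
  finally show ?thesis by simp
qed

lemma Phi_ring_iso:
  assumes "T \<noteq> 0" and "Q \<noteq> 0" and "t = T^2 * inverse Q - 2"
  shows "Phi T Q \<in> ring_iso (RR T Q) (RR t 1)"
proof (rule ring_iso_memI)
  show "bij_betw (Phi T Q) (carrier (RR T Q)) (carrier (RR t 1))"
  proof (rule bij_betw_imageI)
    show "inj_on (Phi T Q) (carrier (RR T Q))"
      using bij_is_inj[OF bij_Phi[OF assms(1,2)]] by (rule inj_on_subset) simp
    have "Y \<in> Phi T Q ` carrier (RR T Q)" if "Y \<in> carrier (RR t 1)" for Y
      using that Phi_in_RR_iff[OF assms] bij_is_surj[OF bij_Phi[OF assms(1,2)]]
      by (metis imageI surjD)
    then show "Phi T Q ` carrier (RR T Q) = carrier (RR t 1)"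
      using Phi_in_RR_iff[OF assms] by blast
  qed
  show "Phi T Q X \<in> carrier (RR t 1)" if "X \<in> carrier (RR T Q)" for X
    using that Phi_in_RR_iff[OF assms] by blast
qed (simp_all add: RR_def Phi_mult Phi_add Phi_one assms(1,2))

lemma Phi_entries:
  assumes "T \<noteq> 0" and "Q \<noteq> 0" and "t = T^2 * inverse Q - 2" and "represents T Q X x"
  shows "T \<cdot>\<^sub>M Phi T Q X = mat22 (x 2 - t * Q * x 0) (- Q * x 0) (Q * x 0) (x 2)"
proof -
  have X: "X = elt T Q (x 0) (x 1)" and "x (1 + 1) = T * x 1 - Q * x (1 - 1)"
    using assms(4) unfolding represents_def by blast+
  then have x2: "x 2 = T * x 1 - Q * x 0" by simp
  have tQ: "t * Q = T^2 - 2 * Q" using assms(2,3) by (simp add: left_diff_distrib)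
  have "(T \<cdot>\<^sub>M X) ** AA T Q = AA T Q ** mat22 (x 2 - t * Q * x 0) (- Q * x 0) (Q * x 0) (x 2)"
    unfolding tQ
    by (simp add: X x2 elt_def AA_def mat22_eq_iff matmul22_nth algebra_simps power2_eq_square)
  then show ?thesis by (simp add: assms(1,2) flip: Phi_smult Phi_eq_iff)
qed

section \<open>Two-sided sequences of powers\<close>

lemma DD_right_cancel:
  fixes X Y :: "rat^2^2"
  assumes "Q \<noteq> 0"
  shows "X ** DD T Q = Y ** DD T Q \<longleftrightarrow> X = Y"
  using assms by (auto simp: mat22_eq_iff[of X] mat22_eq_iff[of "X ** _"] matmul22_nth DD_def)

text \<open>The integers below 0 are reached because \<open>DD T Q\<close> is invertible.\<close>

lemma DD_orbit_unique:
  fixes F G :: "int \<Rightarrow> rat^2^2"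
  assumes Q: "Q \<noteq> 0"
    and F: "\<And>k. F (k + 1) = F k ** DD T Q" and G: "\<And>k. G (k + 1) = G k ** DD T Q"
    and zero: "F 0 = G 0"
  shows "F k = G k"
proof (induction k rule: int_induct[where k = 0])
  case base
  show ?case by (rule zero)
next
  case (step1 i)
  then show ?case by (simp add: F G)
next
  case (step2 i)
  then show ?case using F[of "i - 1"] G[of "i - 1"]
    by (simp add: DD_right_cancel[OF Q])
qed

lemma one_RR: "\<one>\<^bsub>RR T Q\<^esub> = mat 1"
  by (simp add: RR_def)

lemma Phi_even_power:
  assumes "T \<noteq> 0" and "Q \<noteq> 0" and "t = T^2 * inverse Q - 2"
  shows "Phi T Q ((Q powi (- k)) \<cdot>\<^sub>M (X ** (DD T Q [^]\<^bsub>RR T Q\<^esub> (2 * k)))) =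
    Phi T Q X ** (DD t 1 [^]\<^bsub>RR t 1\<^esub> k)"
proof (rule DD_orbit_unique[where Q = 1 and T = t])
  fix k :: int
  let ?D = "\<lambda>k::int. DD T Q [^]\<^bsub>RR T Q\<^esub> k"
  have "?D (2 * (k + 1)) = ?D (2 * k + 1 + 1)" by (simp add: algebra_simps)
  also have "\<dots> = ?D (2 * k) ** (DD T Q ** DD T Q)"
    by (simp only: DD_pow_add1[OF assms(2)] matrix_mul_assoc)
  finally have "Phi T Q (X ** ?D (2 * (k + 1))) =
      Phi T Q (X ** ?D (2 * k)) ** Phi T Q (DD T Q ** DD T Q)"
    by (simp add: matrix_mul_assoc flip: Phi_mult[OF assms(1,2)])
  moreover have "Q powi (- (k + 1)) * Q = Q powi (- k)"
    using assms(2) power_int_add_1[of Q "- (k + 1)"] by simp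
  ultimately show "Phi T Q (Q powi (- (k + 1)) \<cdot>\<^sub>M (X ** ?D (2 * (k + 1)))) =
      Phi T Q (Q powi (- k) \<cdot>\<^sub>M (X ** ?D (2 * k))) ** DD t 1"
    by (simp only: Phi_smult Phi_square[OF assms] smult_mat_matmul smult_mat_smult_mat)
qed (simp_all add: DD_pow_add1 one_RR smult_mat_one matrix_mul_assoc)

theorem proposition3:
  fixes T Q t :: rat
  assumes "T \<noteq> 0" and "Q \<noteq> 0" and "t = T^2 * inverse Q - 2"
  shows "invertible (AA T Q) \<and>
    Phi T Q \<in> ring_iso (RR T Q) (RR t 1) \<and>
    (\<forall>X\<in>carrier (RR T Q). \<forall>x. represents T Q X x \<longrightarrow>
       T \<cdot>\<^sub>M Phi T Q X = mat22 (x 2 - t * Q * x 0) (- Q * x 0) (Q * x 0) (x 2)) \<and>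
    Phi T Q (DD T Q ** DD T Q) = Q \<cdot>\<^sub>M DD t 1 \<and>
    (\<forall>X\<in>carrier (RR T Q). \<forall>k::int.
       Phi T Q ((Q powi (- k)) \<cdot>\<^sub>M (X ** (DD T Q [^]\<^bsub>RR T Q\<^esub> (2 * k)))) =
       Phi T Q X ** (DD t 1 [^]\<^bsub>RR t 1\<^esub> k))"
  using invertible_AA[OF assms(1,2)] Phi_ring_iso[OF assms] Phi_entries[OF assms]
    Phi_square[OF assms] Phi_even_power[OF assms]
  by blast

end
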